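(* Every GCC subspace of $\mathbb{R}$ is a continuous image of the space $C\times\mathbb{R}$, where $C$ is the Cantor set.
   Context: A topological space $X$ is a GCC space (generalized compact and connected space) if it cannot be represented as a union of infinitely many of its disjoint non-empty open subsets. A GCC subspace of $\mathbb R$ is a subset of $\mathbb R$ which, with the subspace topology inherited from the usual topology of $\mathbb R$, is a GCC space. *)

theory Defs
  imports "HOL-Analysis.Analysis"
begin

text \<open>Under this definition the empty space is GCC.\<close>

definition GCC_space :: "'a topology \<Rightarrow> bool" where
  "GCC_space X \<longleftrightarrow>
     \<not> (\<exists>\<U>. infinite \<U> \<and> pairwise disjnt \<U> \<and>
          (\<forall>U\<in>\<U>. openin X U \<and> U \<noteq> {}) \<and> \<Union>\<U> = topspace X)"

text \<open>The set left after \<open>n\<close> rounds of deleting open middle thirds, starting from the unit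
  interval: by self-similarity, round \<open>n + 1\<close> leaves two copies of what round \<open>n\<close> leaves,
  scaled by \<open>1 / 3\<close>, one starting at \<open>0\<close> and the other at \<open>2 / 3\<close>.\<close>

primrec cantor_stage :: "nat \<Rightarrow> real set" where
  "cantor_stage 0 = {0..1}"
| "cantor_stage (Suc n) = (\<lambda>x. x / 3) ` cantor_stage n \<union> (\<lambda>x. 2 / 3 + x / 3) ` cantor_stage n"

definition cantor_set :: "real set" where
  "cantor_set = (\<Inter>n. cantor_stage n)"

end

theory Submission
  imports Defs
begin

text \<open>
  The idea is to write \<open>S\<close> as a compact set of points, each of which is swept over a whole
  interval by the real parameter.

  Continuous images of GCC spaces are GCC (\<open>GCC_space_continuous_image\<close>), so \<open>S\<close> may be replaced
  by \<open>arctan ` S\<close>, which is bounded.  Let \<open>U\<close> be the interior of \<open>S\<close> and \<open>d x\<close> the distance from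
  \<open>x\<close> to the complement of \<open>U\<close>.  Letting \<open>t\<close> run through the reals, \<open>x + (2 / pi * arctan t) * d x\<close>
  runs through the ball of radius \<open>d x\<close> about \<open>x\<close>, or stays at \<open>x\<close> if \<open>x\<close> is not in \<open>U\<close>.  Hence all
  of \<open>S\<close> is obtained if \<open>x\<close> ranges over the set \<open>L\<close> consisting of \<open>S - U\<close> and the midpoints of the
  components of \<open>U\<close>, and this sweep is jointly continuous since \<open>d\<close> is.

  The GCC property makes \<open>L\<close> compact.  If \<open>S\<close> misses \<open>x\<close>, then on each side of \<open>x\<close> it is locally
  empty or everything (\<open>GCC_one_sided\<close>): otherwise infinitely many gaps of \<open>S\<close> would accumulate
  at \<open>x\<close> and cut \<open>S\<close> into infinitely many open pieces.  So near \<open>x\<close> there are only points of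
  intervals that end at \<open>x\<close>, and no midpoints; that is, \<open>L\<close> cannot accumulate at \<open>x\<close>.

  It remains that every non-empty compact set \<open>L\<close> of reals is a continuous image of the Cantor set
  (\<open>compact_real_image_of_cantor_set\<close>).  The Cantor function, rescaled, maps the Cantor set onto the
  convex hull of \<open>L\<close>.  The preimage \<open>D\<close> of \<open>L\<close> is closed in the Cantor set, and it is a retract of it:
  each gap of \<open>D\<close> can be cut at a point outside the Cantor set, and the two halves be sent to the
  respective ends of the gap (\<open>continuous_retraction_codense\<close>).
\<close>

section \<open>GCC spaces\<close>

lemma GCC_space_continuous_image:
  assumes "GCC_space X" "continuous_map X Y h" "h ` topspace X = topspace Y"
  shows "GCC_space Y"
  unfolding GCC_space_def
proof
  assume "\<exists>\<V>. infinite \<V> \<and> pairwise disjnt \<V> \<and>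
            (\<forall>V\<in>\<V>. openin Y V \<and> V \<noteq> {}) \<and> \<Union>\<V> = topspace Y"
  then obtain \<V> where V: "infinite \<V>" "pairwise disjnt \<V>"
      "\<And>V. V \<in> \<V> \<Longrightarrow> openin Y V" "\<And>V. V \<in> \<V> \<Longrightarrow> V \<noteq> {}" "\<Union>\<V> = topspace Y"
    by blast
  define pre where "pre = (\<lambda>V. {x \<in> topspace X. h x \<in> V})"
  have im: "h ` pre V = V" if "V \<in> \<V>" for V
  proof -
    have "V \<subseteq> topspace Y" using that V(5) by blast
    then have "y \<in> h ` topspace X" if "y \<in> V" for y using that assms(3) by blast
    then show ?thesis unfolding pre_def by blast
  qed
  then have "inj_on pre \<V>" by (metis inj_onI)
  then have "infinite (pre ` \<V>)" using V(1) finite_imageD by blast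
  moreover have "pairwise disjnt (pre ` \<V>)"
    using V(2) unfolding pairwise_def disjnt_def pre_def by fastforce
  moreover have "\<forall>W\<in>pre ` \<V>. openin X W \<and> W \<noteq> {}"
  proof
    fix W assume "W \<in> pre ` \<V>"
    then obtain V where W: "W = pre V" "V \<in> \<V>" by blast
    then have "W \<noteq> {}" using im[OF W(2)] V(4)[OF W(2)] by auto
    then show "openin X W \<and> W \<noteq> {}"
      using openin_continuous_map_preimage[OF assms(2) V(3)[OF W(2)]] W(1) by (simp add: pre_def)
  qed
  moreover have "\<Union>(pre ` \<V>) = topspace X"
  proof -
    have "\<exists>V\<in>\<V>. h x \<in> V" if "x \<in> topspace X" for x
      using that V(5) assms(3) by (metis UnionE imageI)
    then show ?thesis unfolding pre_def by auto
  qed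
  ultimately show False using assms(1) unfolding GCC_space_def by blast
qed

lemma GCC_space_no_infinite_sequence:
  fixes A :: "nat \<Rightarrow> 'a set"
  assumes "GCC_space X" "\<And>n. openin X (A n)" "\<And>n. A n \<noteq> {}"
    and dis: "\<And>m n. m < n \<Longrightarrow> A m \<inter> A n = {}" and "(\<Union>n. A n) = topspace X"
  shows False
proof -
  have dis': "A m \<inter> A n = {}" if "m \<noteq> n" for m n
    using dis[of m n] dis[of n m] that by (cases "m < n") auto
  then have "inj A" by (metis assms(3) inf.idem injI)
  then have "infinite (range A)" using finite_imageD infinite_UNIV_nat by blast
  moreover have "pairwise disjnt (range A)"
    unfolding pairwise_def disjnt_def using dis' by (metis rangeE)
  ultimately show False using assms(1,2,3,5) unfolding GCC_space_def by blast
qed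

text \<open>If points outside \<open>S\<close> and points of \<open>S\<close> both accumulated at \<open>x\<close> from the right, there would be
  points \<open>y n\<close> outside \<open>S\<close> decreasing to \<open>x\<close> with \<open>S\<close> meeting every interval between consecutive ones;
  these intervals would split \<open>S\<close> into infinitely many open pieces.\<close>

lemma GCC_right_sided:
  fixes S :: "real set"
  assumes gcc: "GCC_space (top_of_set S)" and x: "x \<notin> S"
  shows "\<exists>e>0. S \<inter> {x<..<x+e} = {} \<or> {x<..<x+e} \<subseteq> S"
proof (rule ccontr)
  assume "\<not> ?thesis"
  then have acc: "\<exists>s. s \<in> S \<and> x < s \<and> s < x + e" "\<exists>y. y \<notin> S \<and> x < y \<and> y < x + e"
    if "e > 0" for e
    using that by (auto simp: subset_iff disjoint_iff)
  have "\<exists>y. \<forall>n. (y n \<notin> S \<and> x < y n) \<and>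
          (y (Suc n) < y n \<and> y (Suc n) < x + 1 / real (Suc n) \<and> S \<inter> {y (Suc n)<..<y n} \<noteq> {})"
  proof (rule dependent_nat_choice)
    show "\<exists>y. y \<notin> S \<and> x < y" using acc(2)[of 1] by auto
  next
    fix y n assume y: "y \<notin> S \<and> x < y"
    obtain s where s: "s \<in> S" "x < s" "s < y" using acc(1)[of "y - x"] y by auto
    obtain z where "z \<notin> S" "x < z" "z < x + min (s - x) (1 / real (Suc n))"
      using acc(2)[of "min (s - x) (1 / real (Suc n))"] s by auto
    then show "\<exists>z. (z \<notin> S \<and> x < z) \<and>
        (z < y \<and> z < x + 1 / real (Suc n) \<and> S \<inter> {z<..<y} \<noteq> {})"
      using s by (intro exI[of _ z]) auto
  qed
  then obtain y where y: "\<And>n. y n \<notin> S" "\<And>n. x < y n" "\<And>n. y (Suc n) < y n"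
      "\<And>n. y (Suc n) < x + 1 / real (Suc n)" "\<And>n. S \<inter> {y (Suc n)<..<y n} \<noteq> {}"
    by blast
  have anti: "y n \<le> y m" if "m \<le> n" for m n
    using lift_Suc_antimono_le[of y] y(3) that by (meson less_imp_le)
  \<comment> \<open>The part of \<open>S\<close> left of \<open>x\<close> may be empty, so it is joined to the part right of \<open>y 1\<close>, which
    has a point below \<open>y 0\<close>.\<close>
  define V where "V = (\<lambda>n. case n of 0 \<Rightarrow> {..<x} \<union> {y 1<..} | Suc k \<Rightarrow> {y (Suc (Suc k))<..<y (Suc k)})"
  define A where "A = (\<lambda>n. S \<inter> V n)"
  show False
  proof (rule GCC_space_no_infinite_sequence[OF gcc])
    show "openin (top_of_set S) (A n)" for n
      unfolding A_def V_def by (cases n) (auto intro!: openin_open_Int)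
    show "A n \<noteq> {}" for n
      using y(5)[of n] unfolding A_def V_def by (cases n) auto
    show "A m \<inter> A n = {}" if mn: "m < n" for m n
    proof -
      obtain k where n: "n = Suc k" using less_imp_Suc_add[OF mn] by blast
      show ?thesis
      proof (cases m)
        case 0
        then show ?thesis using anti[of 1 "Suc k"] y(2)[of "Suc (Suc k)"] n
          unfolding A_def V_def by auto
      next
        case (Suc j)
        then have "y (Suc k) \<le> y (Suc (Suc j))" using anti that n by auto
        then show ?thesis using Suc n unfolding A_def V_def by auto
      qed
    qed
    have "\<exists>n. z \<in> V n" if z: "z \<in> S" for z
    proof (cases "z < x \<or> y 1 < z")
      case True
      then show ?thesis unfolding V_def by (intro exI[of _ 0]) auto
    next
      case False
      with z x have "x < z" "z \<le> y 1" by (auto simp: not_less order.order_iff_strict)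
      obtain N where "1 / real (Suc N) < z - x"
        using \<open>x < z\<close> reals_Archimedean[of "z - x"] by (auto simp: inverse_eq_divide)
      then have ex: "y (Suc N) < z" using y(4)[of N] by auto
      define n where "n = (LEAST n. y n < z)"
      have n: "y n < z" unfolding n_def using ex by (rule LeastI)
      have less: "\<not> y k < z" if "k < n" for k using that not_less_Least unfolding n_def by blast
      have "n \<noteq> 0" "n \<noteq> 1" using n \<open>z \<le> y 1\<close> y(3)[of 0] by (auto intro: ccontr)
      then obtain k where k: "n = Suc (Suc k)" by (metis One_nat_def not0_implies_Suc)
      then have "z < y (Suc k)" using less[of "Suc k"] y(1)[of "Suc k"] z
        by (metis lessI linorder_neqE)
      then show ?thesis using n k unfolding V_def by (intro exI[of _ "Suc k"]) auto
    qed
    then show "(\<Union>n. A n) = topspace (top_of_set S)" unfolding A_def by auto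
  qed
qed

lemma GCC_one_sided:
  fixes S :: "real set"
  assumes gcc: "GCC_space (top_of_set S)" and x: "x \<notin> S"
  obtains e where "e > 0" "S \<inter> {x<..<x+e} = {} \<or> {x<..<x+e} \<subseteq> S"
    "S \<inter> {x-e<..<x} = {} \<or> {x-e<..<x} \<subseteq> S"
proof -
  obtain e where e: "e > 0" "S \<inter> {x<..<x+e} = {} \<or> {x<..<x+e} \<subseteq> S"
    using GCC_right_sided[OF assms] by blast
  have "GCC_space (top_of_set (uminus ` S))"
    using gcc by (rule GCC_space_continuous_image[where h = uminus])
      (auto intro!: continuous_intros)
  moreover have mem: "z \<in> uminus ` S \<longleftrightarrow> - z \<in> S" for z by force
  ultimately obtain e' where e': "e' > 0"
      "uminus ` S \<inter> {-x<..<-x+e'} = {} \<or> {-x<..<-x+e'} \<subseteq> uminus ` S"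
    using GCC_right_sided[of "uminus ` S" "-x"] x by (metis minus_minus)
  have "S \<inter> {x-e'<..<x} = {} \<or> {x-e'<..<x} \<subseteq> S"
    using e'(2)
  proof
    assume *: "uminus ` S \<inter> {-x<..<-x+e'} = {}"
    have False if "z \<in> S" "x - e' < z" "z < x" for z
    proof -
      have "-z \<in> uminus ` S \<inter> {-x<..<-x+e'}" using that by auto
      then show False using * by blast
    qed
    then show ?thesis by auto
  next
    assume *: "{-x<..<-x+e'} \<subseteq> uminus ` S"
    have "z \<in> S" if "x - e' < z" "z < x" for z
    proof -
      have "-z \<in> {-x<..<-x+e'}" using that by auto
      then have "-z \<in> uminus ` S" using * by blast
      then show ?thesis using mem[of "-z"] by simp
    qed
    then show ?thesis by auto
  qed
  then show ?thesis
    using e e'(1) by (intro that[of "min e e'"]) (auto simp: subset_iff disjoint_iff)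
qed

section \<open>The Cantor set\<close>

lemma compact_cantor_stage: "compact (cantor_stage n)"
  by (induction n) (auto intro!: compact_Un compact_continuous_image continuous_intros)

lemma cantor_stage_subset: "cantor_stage n \<subseteq> {0..1}"
  by (induction n) auto

lemma decseq_cantor_stage: "cantor_stage (Suc n) \<subseteq> cantor_stage n"
proof (induction n)
  case 0
  show ?case using cantor_stage_subset[of "Suc 0"] by simp
next
  case (Suc n)
  then show ?case by (subst (1 2) cantor_stage.simps) blast
qed

lemma closed_cantor_set: "closed cantor_set"
  unfolding cantor_set_def by (intro closed_INT ballI compact_imp_closed compact_cantor_stage)

lemma zero_one_in_cantor_set: "0 \<in> cantor_set" "1 \<in> cantor_set"
proof -
  have "0 \<in> cantor_stage n \<and> 1 \<in> cantor_stage n" for n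
    by (induction n) (auto simp: image_iff intro: bexI[of _ 0] bexI[of _ 1])
  then show "0 \<in> cantor_set" "1 \<in> cantor_set" unfolding cantor_set_def by auto
qed

lemma cantor_set_subset: "cantor_set \<subseteq> {0..1}"
  unfolding cantor_set_def using cantor_stage_subset[of 0] by blast

text \<open>An interval cannot jump over the removed middle third, so it lies in one of the two scaled
  copies, and tripling it reduces \<open>n\<close> by one.\<close>

lemma cantor_stage_interval_length:
  assumes "a \<le> b" "{a..b} \<subseteq> cantor_stage n"
  shows "b - a \<le> (1/3) ^ n"
  using assms
proof (induction n arbitrary: a b)
  case 0
  then show ?case by auto
next
  case (Suc n)
  have split: "z \<in> cantor_stage (Suc n) \<longleftrightarrow>
      z \<le> 1/3 \<and> 3 * z \<in> cantor_stage n \<or> 2/3 \<le> z \<and> 3 * z - 2 \<in> cantor_stage n" for z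
  proof -
    have "z \<in> (\<lambda>x. x / 3) ` cantor_stage n \<longleftrightarrow> 3 * z \<in> cantor_stage n"
      by (auto simp: image_iff mult.commute[of z] intro: bexI[of _ "3 * z"])
    moreover have "z \<in> (\<lambda>x. 2 / 3 + x / 3) ` cantor_stage n \<longleftrightarrow> 3 * z - 2 \<in> cantor_stage n"
      by (auto simp: image_iff diff_divide_distrib intro!: bexI[of _ "3 * z - 2"])
    ultimately show ?thesis using cantor_stage_subset[of n] by auto
  qed
  have "1/2 \<notin> cantor_stage (Suc n)" unfolding split by simp
  then have "\<not> (a \<le> 1/2 \<and> 1/2 \<le> b)" using Suc.prems(2) by (meson atLeastAtMost_iff subsetD)
  then consider "b < 1/2" | "a > 1/2" by linarith
  then show ?case
  proof cases
    case 1
    have "{3 * a..3 * b} \<subseteq> cantor_stage n"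
    proof
      fix z assume "z \<in> {3 * a..3 * b}"
      then have *: "z / 3 \<in> {a..b}" by auto
      then have "z / 3 \<in> cantor_stage (Suc n)" using Suc.prems(2) by blast
      then show "z \<in> cantor_stage n" using split[of "z/3"] 1 * by auto
    qed
    then have "3 * b - 3 * a \<le> (1/3) ^ n" using Suc.prems(1) by (intro Suc.IH) auto
    then show ?thesis by simp
  next
    case 2
    have "{3 * a - 2..3 * b - 2} \<subseteq> cantor_stage n"
    proof
      fix z assume "z \<in> {3 * a - 2..3 * b - 2}"
      then have *: "(z + 2) / 3 \<in> {a..b}" by auto
      then have "(z + 2) / 3 \<in> cantor_stage (Suc n)" using Suc.prems(2) by blast
      then show "z \<in> cantor_stage n" using split[of "(z + 2)/3"] 2 *
        by (simp add: add_divide_distrib del: cantor_stage.simps)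
    qed
    then have "(3 * b - 2) - (3 * a - 2) \<le> (1/3) ^ n" using Suc.prems(1) by (intro Suc.IH) auto
    then show ?thesis by simp
  qed
qed

lemma cantor_set_codense:
  assumes "a < b"
  shows "\<exists>m. a < m \<and> m < b \<and> m \<notin> cantor_set"
proof (rule ccontr)
  assume "\<not> ?thesis"
  then have sub: "{(2 * a + b) / 3..(a + 2 * b) / 3} \<subseteq> cantor_set" using assms by auto
  obtain n where "(1/3) ^ n < (b - a) / 3"
    using real_arch_pow_inv[of "(b - a) / 3" "1/3"] assms by auto
  moreover have "(a + 2 * b) / 3 - (2 * a + b) / 3 \<le> (1/3) ^ n"
    using sub assms unfolding cantor_set_def
    by (intro cantor_stage_interval_length) auto
  ultimately show False by (simp add: field_simps)
qed

section \<open>The Cantor function\<close>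

text \<open>Approximations of the Cantor function, extended by \<open>0\<close> to the left and by \<open>1\<close> to the right of
  the unit interval.  With this extension the two scaled copies in the recursion can simply be
  averaged: on \<open>{0..1/3}\<close> the right one contributes \<open>0\<close>, on \<open>{2/3..1}\<close> the left one contributes
  \<open>1\<close>.\<close>

primrec cantor_approx :: "nat \<Rightarrow> real \<Rightarrow> real" where
  "cantor_approx 0 x = max 0 (min 1 x)"
| "cantor_approx (Suc n) x = (cantor_approx n (3 * x) + cantor_approx n (3 * x - 2)) / 2"

lemma continuous_on_cantor_approx: "continuous_on A (cantor_approx n)"
proof (induction n arbitrary: A)
  case 0
  show ?case by (simp add: continuous_intros)
next
  case (Suc n)
  have "continuous_on A (\<lambda>x. cantor_approx n (3 * x))"
    "continuous_on A (\<lambda>x. cantor_approx n (3 * x - 2))"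
    by (rule continuous_on_compose2[OF Suc[of UNIV]]; auto intro!: continuous_intros)+
  then show ?case by (simp add: continuous_intros)
qed

lemma cantor_approx_outside:
  "x \<le> 0 \<Longrightarrow> cantor_approx n x = 0" "x \<ge> 1 \<Longrightarrow> cantor_approx n x = 1"
  by (induction n arbitrary: x) auto

text \<open>Consecutive approximations differ only inside the unit interval, and \<open>3 * x\<close> and \<open>3 * x - 2\<close>
  are never both inside; so averaging halves the difference.\<close>

lemma cantor_approx_step: "\<bar>cantor_approx (Suc n) x - cantor_approx n x\<bar> \<le> (1/2) ^ n"
proof (induction n arbitrary: x)
  case 0
  show ?case by (auto simp: max_def min_def abs_if field_simps)
next
  case (Suc n)
  let ?d = "\<lambda>x. cantor_approx (Suc n) x - cantor_approx n x"
  have out: "?d z = 0" if "z \<le> 0 \<or> z \<ge> 1" for z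
    using that cantor_approx_outside by (metis diff_self)
  have "cantor_approx (Suc (Suc n)) x - cantor_approx (Suc n) x = (?d (3 * x) + ?d (3 * x - 2)) / 2"
    by (subst (1 2) cantor_approx.simps) (simp add: field_simps)
  moreover have "?d (3 * x) = 0 \<or> ?d (3 * x - 2) = 0"
    using out[of "3 * x"] out[of "3 * x - 2"] by linarith
  then have "\<bar>?d (3 * x) + ?d (3 * x - 2)\<bar> \<le> (1/2) ^ n"
    using Suc[of "3 * x"] Suc[of "3 * x - 2"] by (elim disjE) linarith+
  then have "\<bar>(?d (3 * x) + ?d (3 * x - 2)) / 2\<bar> \<le> (1/2) ^ Suc n"
    by (simp only: abs_divide power_Suc) simp
  ultimately show ?case by (simp only:)
qed

lemma cantor_function_exists:
  obtains \<phi> :: "real \<Rightarrow> real" where "continuous_on UNIV \<phi>" "\<phi> 0 = 0" "\<phi> 1 = 1"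
    "\<And>x. x \<in> {0..1} \<Longrightarrow> \<phi> (x / 3) = \<phi> x / 2"
    "\<And>x. x \<in> {0..1} \<Longrightarrow> \<phi> (2 / 3 + x / 3) = 1 / 2 + \<phi> x / 2"
proof -
  define \<phi> where "\<phi> = (\<lambda>x. cantor_approx 0 x + (\<Sum>n. cantor_approx (Suc n) x - cantor_approx n x))"
  have "uniform_limit UNIV (\<lambda>n x. \<Sum>i<n. cantor_approx (Suc i) x - cantor_approx i x)
      (\<lambda>x. \<Sum>i. cantor_approx (Suc i) x - cantor_approx i x) sequentially"
    by (rule Weierstrass_m_test[where M = "\<lambda>n. (1/2) ^ n"])
      (use cantor_approx_step in \<open>auto simp del: cantor_approx.simps intro: summable_geometric\<close>)
  moreover have "(\<Sum>i<n. cantor_approx (Suc i) x - cantor_approx i x) =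
      cantor_approx n x - cantor_approx 0 x" for n x
    by (rule sum_lessThan_telescope[where f = "\<lambda>i. cantor_approx i x"])
  ultimately have "uniform_limit UNIV (\<lambda>n x. cantor_approx n x - cantor_approx 0 x)
      (\<lambda>x. \<Sum>i. cantor_approx (Suc i) x - cantor_approx i x) sequentially"
    by (simp only:)
  from uniform_limit_add[OF uniform_limit_const this, of "cantor_approx 0"]
  have unif: "uniform_limit UNIV cantor_approx \<phi> sequentially"
    unfolding \<phi>_def by (simp del: cantor_approx.simps)
  have cont: "continuous_on UNIV \<phi>"
    by (rule uniform_limit_theorem[OF _ unif]) (simp_all add: always_eventually continuous_on_cantor_approx)
  have lim: "(\<lambda>n. cantor_approx n x) \<longlonglongrightarrow> \<phi> x" for x
    using tendsto_uniform_limitI[OF unif] by simp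
  have eq: "\<phi> x = (\<phi> (3 * x) + \<phi> (3 * x - 2)) / 2" for x
  proof (rule LIMSEQ_unique)
    show "(\<lambda>n. cantor_approx (Suc n) x) \<longlonglongrightarrow> \<phi> x" by (rule LIMSEQ_Suc[OF lim])
    show "(\<lambda>n. cantor_approx (Suc n) x) \<longlonglongrightarrow> (\<phi> (3 * x) + \<phi> (3 * x - 2)) / 2"
      unfolding cantor_approx.simps by (intro tendsto_intros lim) simp
  qed
  have out: "\<phi> x = 0" if "x \<le> 0" for x
    using lim[of x] that by (simp add: cantor_approx_outside LIMSEQ_const_iff)
  have out': "\<phi> x = 1" if "x \<ge> 1" for x
    using lim[of x] that by (simp add: cantor_approx_outside LIMSEQ_const_iff)
  show ?thesis
  proof (rule that[OF cont])
    show "\<phi> 0 = 0" "\<phi> 1 = 1" using out[of 0] out'[of 1] by auto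
    show "\<phi> (x / 3) = \<phi> x / 2" if "x \<in> {0..1}" for x
      using eq[of "x/3"] out[of "x - 2"] that by auto
    show "\<phi> (2 / 3 + x / 3) = 1 / 2 + \<phi> x / 2" if "x \<in> {0..1}" for x
    proof -
      have "3 * (2 / 3 + x / 3) = x + 2" "3 * (2 / 3 + x / 3) - 2 = x" by simp_all
      then show ?thesis using eq[of "2/3 + x/3"] out'[of "x + 2"] that
        by (simp only:) (simp add: add_divide_distrib)
    qed
  qed
qed

text \<open>By the functional equations every value is already attained on each stage; compactness carries
  this over to the intersection.\<close>

lemma cantor_set_maps_onto_interval:
  obtains \<phi> :: "real \<Rightarrow> real" where "continuous_on UNIV \<phi>" "\<phi> 0 = 0" "\<phi> 1 = 1"
    "{0..1} \<subseteq> \<phi> ` cantor_set"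
proof -
  obtain \<phi> :: "real \<Rightarrow> real" where \<phi>: "continuous_on UNIV \<phi>" "\<phi> 0 = 0" "\<phi> 1 = 1"
    "\<And>x. x \<in> {0..1} \<Longrightarrow> \<phi> (x / 3) = \<phi> x / 2"
    "\<And>x. x \<in> {0..1} \<Longrightarrow> \<phi> (2 / 3 + x / 3) = 1 / 2 + \<phi> x / 2"
    using cantor_function_exists by blast
  have stage: "\<exists>x\<in>cantor_stage n. \<phi> x = y" if "y \<in> {0..1}" for n y
    using that
  proof (induction n arbitrary: y)
    case 0
    then show ?case
      using IVT'[of \<phi> 0 y 1] \<phi>(2,3) continuous_on_subset[OF \<phi>(1), of "{0..1}"]
      by (auto simp: Bex_def)
  next
    case (Suc n)
    show ?case
    proof (cases "y \<le> 1/2")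
      case True
      then obtain x where "x \<in> cantor_stage n" "\<phi> x = 2 * y" using Suc.IH[of "2 * y"] Suc.prems by auto
      then show ?thesis using \<phi>(4)[of x] cantor_stage_subset[of n]
        by (intro bexI[of _ "x/3"]) auto
    next
      case False
      then obtain x where "x \<in> cantor_stage n" "\<phi> x = 2 * y - 1"
        using Suc.IH[of "2 * y - 1"] Suc.prems by auto
      then show ?thesis using \<phi>(5)[of x] cantor_stage_subset[of n]
        by (intro bexI[of _ "2/3 + x/3"]) (auto simp: field_simps)
    qed
  qed
  have "y \<in> \<phi> ` cantor_set" if y: "y \<in> {0..1}" for y
  proof -
    have cl: "closed (\<phi> -` {y})"
      using \<phi>(1) by (simp add: continuous_on_closed_vimage)
    have "\<Inter> (range (\<lambda>n. cantor_stage n \<inter> \<phi> -` {y})) \<noteq> {}"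
    proof (rule compact_nest)
      show "compact (cantor_stage n \<inter> \<phi> -` {y})" for n
        using compact_cantor_stage cl by (rule compact_Int_closed)
      show "cantor_stage n \<inter> \<phi> -` {y} \<noteq> {}" for n using stage[OF y] by auto
      show "cantor_stage n \<inter> \<phi> -` {y} \<subseteq> cantor_stage m \<inter> \<phi> -` {y}" if "m \<le> n" for m n
        using lift_Suc_antimono_le[of cantor_stage, OF decseq_cantor_stage that] by blast
    qed
    then show ?thesis unfolding cantor_set_def by auto
  qed
  then show ?thesis using that \<phi>(1-3) by blast
qed

section \<open>Compact sets of reals as images of the Cantor set\<close>

lemma gap_exists:
  fixes D :: "real set"
  assumes D: "closed D" and x: "x \<notin> D" and p: "p \<in> D" "p < x" and q: "q \<in> D" "x < q"
  shows "\<exists>a b. a \<in> D \<and> b \<in> D \<and> a < x \<and> x < b \<and> {a<..<b} \<inter> D = {}"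
proof -
  let ?A = "D \<inter> {..x}" and ?B = "D \<inter> {x..}"
  have "Sup ?A \<in> ?A" using D p by (intro closed_contains_Sup) (auto intro: bdd_aboveI[of _ x])
  moreover have "Inf ?B \<in> ?B" using D q by (intro closed_contains_Inf) (auto intro: bdd_belowI[of _ x])
  moreover have "z \<le> Sup ?A" if "z \<in> D" "z \<le> x" for z
    using that by (intro cSup_upper) (auto intro: bdd_aboveI[of _ x])
  moreover have "Inf ?B \<le> z" if "z \<in> D" "x \<le> z" for z
    using that by (intro cInf_lower) (auto intro: bdd_belowI[of _ x])
  moreover have "Sup ?A \<noteq> x" "Inf ?B \<noteq> x" using calculation(1,2) x by auto
  ultimately have ends: "Sup ?A \<in> D" "Inf ?B \<in> D" "Sup ?A < x" "x < Inf ?B"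
    and gap: "\<And>z. z \<in> D \<Longrightarrow> z \<le> Sup ?A \<or> Inf ?B \<le> z"
    using linear by (fastforce simp: less_le)+
  then have "{Sup ?A<..<Inf ?B} \<inter> D = {}"
    by (meson disjoint_iff greaterThanLessThan_iff not_le)
  then show ?thesis using ends by blast
qed

text \<open>Each gap of \<open>D\<close> is cut at a point outside \<open>K\<close>, so that moving both halves to the ends of the gap
  is continuous on \<open>K - D\<close>.  Taking the cut in the middle half of the gap ensures that points move
  at most three times their distance to \<open>D\<close>, which gives continuity at \<open>D\<close>.\<close>

lemma continuous_retraction_codense:
  fixes K D :: "real set"
  assumes codense: "\<And>a b. a < b \<Longrightarrow> \<exists>m. a < m \<and> m < b \<and> m \<notin> K"
    and D: "closed D" "D \<subseteq> K" "p \<in> D" "q \<in> D" and K: "K \<subseteq> {p..q}"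
  obtains r where "continuous_on K r" "r ` K = D" "\<And>x. x \<in> D \<Longrightarrow> r x = x"
proof -
  have "\<forall>x. \<exists>a b. x \<in> K - D \<longrightarrow> a \<in> D \<and> b \<in> D \<and> a < x \<and> x < b \<and> {a<..<b} \<inter> D = {}"
  proof
    fix x
    have "\<exists>a b. a \<in> D \<and> b \<in> D \<and> a < x \<and> x < b \<and> {a<..<b} \<inter> D = {}" if "x \<in> K - D"
    proof -
      have "p < x" "x < q" using that K D(3,4) by (auto simp: order.order_iff_strict)
      then show ?thesis using gap_exists[of D x p q] D that by auto
    qed
    then show "\<exists>a b. x \<in> K - D \<longrightarrow> a \<in> D \<and> b \<in> D \<and> a < x \<and> x < b \<and> {a<..<b} \<inter> D = {}" by blast
  qed
  then obtain l u where lu: "\<And>x. x \<in> K - D \<Longrightarrow>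
      l x \<in> D \<and> u x \<in> D \<and> l x < x \<and> x < u x \<and> {l x<..<u x} \<inter> D = {}" by metis
  have gap: "z \<le> l x \<or> u x \<le> z" if "x \<in> K - D" "z \<in> D" for x z
  proof (rule ccontr)
    assume "\<not> ?thesis"
    then have "z \<in> {l x<..<u x} \<inter> D" using that(2) by auto
    then show False using lu[OF that(1)] by blast
  qed
  have "\<forall>a b. \<exists>m. a < b \<longrightarrow> (3 * a + b) / 4 < m \<and> m < (a + 3 * b) / 4 \<and> m \<notin> K"
  proof (intro allI)
    fix a b :: real
    show "\<exists>m. a < b \<longrightarrow> (3 * a + b) / 4 < m \<and> m < (a + 3 * b) / 4 \<and> m \<notin> K"
      using codense[of "(3 * a + b) / 4" "(a + 3 * b) / 4"] by auto
  qed
  then obtain cut where cut: "\<And>a b. a < b \<Longrightarrow>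
      (3 * a + b) / 4 < cut a b \<and> cut a b < (a + 3 * b) / 4 \<and> cut a b \<notin> K" by metis
  define r where "r = (\<lambda>x. if x \<in> D then x else if x < cut (l x) (u x) then l x else u x)"
  have r_D: "r x = x" if "x \<in> D" for x using that by (simp add: r_def)
  have r_in: "r x \<in> D" if "x \<in> K" for x using that lu[of x] by (auto simp: r_def)
  have same_gap: "l y = l x \<and> u y = u x"
    if "x \<in> K - D" "y \<in> K - D" "l x < y" "y < u x" for x y
  proof -
    have x: "l x \<in> D" "u x \<in> D" and y: "l y \<in> D" "u y \<in> D" "l y < y" "y < u y"
      using lu that(1,2) by auto
    show ?thesis
      using gap[OF that(1) y(1)] gap[OF that(1) y(2)] gap[OF that(2) x(1)] gap[OF that(2) x(2)]
        that(3,4) y(3,4) by linarith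
  qed
  have near: "\<bar>r x - x\<bar> \<le> 3 * \<bar>x - z\<bar>" if x: "x \<in> K" and z: "z \<in> D" for x z
  proof (cases "x \<in> D")
    case False
    then have xK: "x \<in> K - D" using x by auto
    have "z \<le> l x \<or> u x \<le> z" using gap[OF xK z] .
    moreover have "(3 * l x + u x) / 4 < cut (l x) (u x)" "cut (l x) (u x) < (l x + 3 * u x) / 4"
      using cut lu[OF xK] by (meson less_trans)+
    ultimately show ?thesis using lu[OF xK] False unfolding r_def by (auto simp: abs_if)
  qed (simp add: r_D)
  have "continuous_on K r"
    unfolding continuous_on_eq_continuous_within
  proof
    fix x assume x: "x \<in> K"
    show "continuous (at x within K) r"
    proof (cases "x \<in> D")
      case True
      show ?thesis
        unfolding continuous_within_eps_delta
      proof (intro allI impI)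
        fix e :: real assume "e > 0"
        show "\<exists>d>0. \<forall>y\<in>K. dist y x < d \<longrightarrow> dist (r y) (r x) < e"
        proof (intro exI[of _ "e/4"] conjI ballI impI)
          fix y assume "y \<in> K" "dist y x < e/4"
          then show "dist (r y) (r x) < e"
            using near[OF \<open>y \<in> K\<close> True] r_D[OF True] abs_triangle_ineq[of "r y - y" "y - x"]
            unfolding dist_real_def by simp
        qed (use \<open>e > 0\<close> in auto)
      qed
    next
      case False
      then have xK: "x \<in> K - D" using x by auto
      define m where "m = cut (l x) (u x)"
      have m: "l x < m" "m < u x" "m \<notin> K"
        using cut[of "l x" "u x"] lu[OF xK] unfolding m_def by auto
      define V where "V = (if x < m then {l x<..<m} else {m<..<u x})"
      have V: "open V" "x \<in> V" using lu[OF xK] m x unfolding V_def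
        by (auto simp: order.order_iff_strict)
      have "r y = r x" if "y \<in> K" "y \<in> V" for y
      proof -
        have y: "l x < y" "y < u x" using that m unfolding V_def by (auto split: if_splits)
        then have yK: "y \<in> K - D" using lu[OF xK] that(1) by auto
        have "l y = l x" "u y = u x" using same_gap[OF xK yK y] by auto
        moreover have "y < m \<longleftrightarrow> x < m" using that(2) unfolding V_def by (auto split: if_splits)
        ultimately show ?thesis using xK yK unfolding r_def m_def by auto
      qed
      then have "eventually (\<lambda>y. r x = r y) (at x within K)"
        unfolding eventually_at_topological using V by metis
      then show ?thesis
        unfolding continuous_within
        by (rule Lim_transform_eventually[OF tendsto_const])
    qed
  qed
  moreover have "r ` K = D" using r_in r_D D(2) by force
  ultimately show ?thesis using that r_D by blast
qed

lemma compact_real_image_of_cantor_set: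
  fixes L :: "real set"
  assumes L: "compact L" "L \<noteq> {}"
  obtains \<psi> where "continuous_on cantor_set \<psi>" "\<psi> ` cantor_set = L"
proof -
  obtain \<phi> :: "real \<Rightarrow> real" where \<phi>: "continuous_on UNIV \<phi>" "\<phi> 0 = 0" "\<phi> 1 = 1"
    "{0..1} \<subseteq> \<phi> ` cantor_set" using cantor_set_maps_onto_interval by blast
  define a where "a = Inf L"
  define b where "b = Sup L"
  have bdd: "bdd_below L" "bdd_above L"
    using L(1) by (simp_all add: bounded_imp_bdd_below bounded_imp_bdd_above compact_imp_bounded)
  have ab: "a \<in> L" "b \<in> L"
    using L bdd closed_contains_Inf closed_contains_Sup compact_imp_closed
    unfolding a_def b_def by blast+
  have hull: "a \<le> y" "y \<le> b" if "y \<in> L" for y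
    using that bdd by (auto simp: a_def b_def intro: cInf_lower cSup_upper)
  define \<theta> where "\<theta> = (\<lambda>x. a + (b - a) * \<phi> x)"
  have cont: "continuous_on A \<theta>" for A
    unfolding \<theta>_def using continuous_on_subset[OF \<phi>(1)] by (intro continuous_intros) auto
  define D where "D = cantor_set \<inter> \<theta> -` L"
  have onto: "\<theta> ` D = L"
  proof -
    have "\<exists>x\<in>cantor_set. \<theta> x = y" if y: "y \<in> L" for y
    proof (cases "a = b")
      case True
      then show ?thesis using hull[OF y] zero_one_in_cantor_set(1)
        by (intro bexI[of _ 0]) (auto simp: \<theta>_def)
    next
      case False
      then have "a < b" using hull[OF ab(1)] by auto
      then have "(y - a) / (b - a) \<in> {0..1}" using hull[OF y] by (auto simp: field_simps)
      then obtain x where "x \<in> cantor_set" "\<phi> x = (y - a) / (b - a)" using \<phi>(4) by force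
      then show ?thesis using \<open>a < b\<close> by (intro bexI[of _ x]) (auto simp: \<theta>_def)
    qed
    then show ?thesis unfolding D_def by force
  qed
  have "closed (\<theta> -` L)"
    using cont[of UNIV] L(1) by (simp add: closed_vimage compact_imp_closed)
  then have "closed D" unfolding D_def using closed_cantor_set by blast
  moreover have "D \<subseteq> cantor_set" unfolding D_def by auto
  moreover have "0 \<in> D" "1 \<in> D"
    using zero_one_in_cantor_set ab \<phi>(2,3) unfolding D_def \<theta>_def by auto
  ultimately obtain r where r: "continuous_on cantor_set r" "r ` cantor_set = D"
    using continuous_retraction_codense[OF cantor_set_codense _ _ _ _ cantor_set_subset, of D] by metis
  have "continuous_on cantor_set (\<theta> \<circ> r)"
    using r(1) cont by (rule continuous_on_compose)
  moreover have "(\<theta> \<circ> r) ` cantor_set = L" using onto r(2) by (simp only: image_comp[symmetric])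
  ultimately show ?thesis using that by blast
qed

section \<open>Sweeping a GCC set out of a compact subset\<close>

text \<open>The two conditions cutting out \<open>L\<close> hold for the points outside the interior, where the distance
  is \<open>0\<close>, and for the midpoints of the components of the interior.  They are closed conditions, so
  \<open>L\<close> is closed in \<open>S\<close>; by the GCC property it does not accumulate at points outside \<open>S\<close>.\<close>

lemma compact_midpoint_set:
  fixes S :: "real set"
  assumes gcc: "GCC_space (top_of_set S)" and bdd: "bounded S"
  defines "d \<equiv> \<lambda>x. infdist x (- interior S)"
  shows "compact {x \<in> S. x - d x \<notin> interior S \<and> x + d x \<notin> interior S}" (is "compact ?L")
proof -
  have d_le: "d y \<le> \<bar>y - x\<bar>" if "x \<notin> interior S" for x y
    using infdist_le[of x "- interior S" y] that by (simp add: d_def dist_real_def)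
  have d_ge: "z \<in> interior S" if "\<bar>y - z\<bar> < d y" for y z
    using d_le[of z y] that by force
  have d_nonneg: "0 \<le> d x" for x by (simp add: d_def infdist_nonneg)
  have contd: "continuous_on UNIV d" unfolding d_def by (intro continuous_intros)
  have "closed ((\<lambda>x. x - d x) -` (- interior S) \<inter> (\<lambda>x. x + d x) -` (- interior S))"
    by (intro closed_Int closed_vimage continuous_intros contd) auto
  then have closed_cond: "closed {x. x - d x \<notin> interior S \<and> x + d x \<notin> interior S}"
    by (simp add: vimage_def Collect_conj_eq)
  have "x \<in> ?L" if x: "x islimpt ?L" for x
  proof -
    have "x islimpt {x. x - d x \<notin> interior S \<and> x + d x \<notin> interior S}"
      using x by (rule islimpt_subset) auto
    then have cond: "x - d x \<notin> interior S \<and> x + d x \<notin> interior S"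
      using closed_cond unfolding closed_limpt by blast
    have "x \<in> S"
    proof (rule ccontr)
      assume "x \<notin> S"
      then have xU: "x \<notin> interior S" using interior_subset by blast
      obtain e where e: "e > 0" "S \<inter> {x<..<x+e} = {} \<or> {x<..<x+e} \<subseteq> S"
          "S \<inter> {x-e<..<x} = {} \<or> {x-e<..<x} \<subseteq> S"
        using GCC_one_sided[OF gcc \<open>x \<notin> S\<close>] by blast
      obtain y where y: "y \<in> ?L" "y \<noteq> x" "dist y x < e/2"
        using x e(1) unfolding islimpt_approachable by (meson half_gt_zero)
      \<comment> \<open>Then \<open>y\<close> lies in an interval of \<open>S\<close> ending at \<open>x\<close>, and its distance to the complement of the
        interior is at most its distance to \<open>x\<close>; going that far away from \<open>x\<close> stays in the interval.\<close>
      have dy: "d y \<le> \<bar>y - x\<bar>" using d_le[OF xU] .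
      show False
      proof (cases "x < y")
        case True
        then have "{x<..<x+e} \<subseteq> S" using e y by (auto simp: dist_real_def)
        then have sub: "{x<..<x+e} \<subseteq> interior S" by (simp add: interior_maximal)
        have "y + d y \<in> {x<..<x+e}"
          using True dy d_nonneg[of y] y(3) by (auto simp: dist_real_def)
        then show False using sub y(1) by blast
      next
        case False
        then have "y < x" using y(2) by auto
        then have "{x-e<..<x} \<subseteq> S" using e y by (auto simp: dist_real_def)
        then have sub: "{x-e<..<x} \<subseteq> interior S" by (simp add: interior_maximal)
        have "y - d y \<in> {x-e<..<x}"
          using \<open>y < x\<close> dy d_nonneg[of y] y(3) by (auto simp: dist_real_def)
        then show False using sub y(1) by blast
      qed
    qed
    then show ?thesis using cond by blast
  qed
  then have "closed ?L" unfolding closed_limpt by blast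
  moreover have "bounded ?L" using bdd by (rule bounded_subset) auto
  ultimately show ?thesis by (simp add: compact_eq_bounded_closed)
qed

text \<open>Boundedness makes every component of the interior a bounded interval \<open>{a<..<b}\<close>; its midpoint
  lies in \<open>L\<close> and is at distance \<open>(b - a) / 2\<close> from the complement, so its sweep covers the whole
  component.\<close>

lemma bounded_GCC_sweep:
  fixes S :: "real set"
  assumes gcc: "GCC_space (top_of_set S)" and bdd: "bounded S"
  obtains L and F :: "real \<times> real \<Rightarrow> real"
  where "compact L" "continuous_on UNIV F" "F ` (L \<times> UNIV) = S"
proof -
  define U where "U = interior S"
  define d where "d = (\<lambda>x. infdist x (- U))"
  define L where "L = {x \<in> S. x - d x \<notin> U \<and> x + d x \<notin> U}"
  define F where "F = (\<lambda>(x, t). x + (2 / pi * arctan t) * d x)"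
  have compL: "compact L"
    using compact_midpoint_set[OF gcc bdd] unfolding L_def d_def U_def .
  have US: "U \<subseteq> S" unfolding U_def by (rule interior_subset)
  have contd: "continuous_on A d" for A unfolding d_def by (intro continuous_intros)
  have contF: "continuous_on UNIV F"
    unfolding F_def case_prod_beta
    by (intro continuous_intros continuous_on_compose2[OF contd[of UNIV]]) auto
  have d_ge: "z \<in> U" if "\<bar>y - z\<bar> < d y" for y z
    using infdist_le[of z "- U" y] that by (force simp: d_def dist_real_def)
  have d_nonneg: "0 \<le> d x" for x by (simp add: d_def infdist_nonneg)
  have d_out: "d x = 0" if "x \<notin> U" for x using that by (simp add: d_def)
  have into: "F (x, t) \<in> S" if "x \<in> L" for x t
  proof (cases "d x = 0")
    case True
    then show ?thesis using that by (simp add: F_def L_def)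
  next
    case False
    then have pos: "d x > 0" using d_nonneg[of x] by simp
    have "\<bar>2 / pi * arctan t\<bar> < 1"
      using arctan_bounded[of t] by (auto simp: abs_less_iff field_simps)
    then have "\<bar>2 / pi * arctan t\<bar> * d x < 1 * d x"
      using pos by (rule mult_strict_right_mono)
    then have "\<bar>(2 / pi * arctan t) * d x\<bar> < d x" using pos by (simp only: abs_mult)
    then show ?thesis using d_ge[of x "F (x, t)"] US by (auto simp: F_def)
  qed
  have onto: "\<exists>x\<in>L. \<exists>t. F (x, t) = y" if y: "y \<in> S" for y
  proof (cases "y \<in> U")
    case False
    then show ?thesis using y d_out[OF False]
      by (intro bexI[of _ y] exI[of _ 0]) (auto simp: F_def L_def)
  next
    case True
    obtain B where B: "\<And>x. x \<in> S \<Longrightarrow> \<bar>x\<bar> \<le> B" using bdd unfolding bounded_real by blast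
    have "- B - 1 \<in> - U" "B + 1 \<in> - U" using B[of "- B - 1"] B[of "B + 1"] B[OF y] US by auto
    moreover have "- B - 1 < y" "y < B + 1" using B[OF y] by auto
    moreover have "closed (- U)" unfolding U_def by auto
    ultimately obtain a b where ab: "a \<notin> U" "b \<notin> U" "a < y" "y < b" "{a<..<b} \<inter> - U = {}"
      using gap_exists[of "- U" y "- B - 1" "B + 1"] True by auto
    define m where "m = (a + b) / 2"
    have dm: "d m = (b - a) / 2"
    proof (rule antisym)
      show "d m \<le> (b - a) / 2"
        using infdist_le[of a "- U" m] ab by (simp add: d_def m_def dist_real_def field_simps)
      have "(b - a) / 2 \<le> dist m z" if "z \<in> - U" for z
      proof -
        have "z \<le> a \<or> b \<le> z" using that ab(5) by force
        then show ?thesis by (auto simp: m_def dist_real_def abs_if field_simps)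
      qed
      then show "(b - a) / 2 \<le> d m"
        unfolding d_def using ab(1) by (subst infdist_notempty) (blast intro: cINF_greatest)+
    qed
    have "m \<in> {a<..<b}" using ab by (simp add: m_def)
    then have "m \<in> U" using ab(5) by blast
    have "m - d m = a" "m + d m = b" unfolding dm by (simp_all add: m_def field_simps)
    then have "m \<in> L" using \<open>m \<in> U\<close> US ab unfolding L_def by auto
    moreover have "F (m, tan (pi / 2 * ((y - m) / d m))) = y"
    proof -
      have s: "-1 < (y - m) / d m" "(y - m) / d m < 1" "d m > 0"
        using ab unfolding dm by (auto simp: m_def field_simps)
      have "pi / 2 * -1 < pi / 2 * ((y - m) / d m)" "pi / 2 * ((y - m) / d m) < pi / 2 * 1"
        using s(1,2) pi_half_gt_zero by (blast intro: mult_strict_left_mono)+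
      then have "- (pi / 2) < pi / 2 * ((y - m) / d m)" "pi / 2 * ((y - m) / d m) < pi / 2"
        by simp_all
      then show ?thesis using s(3) by (simp add: F_def arctan_tan)
    qed
    ultimately show ?thesis by blast
  qed
  have "F ` (L \<times> UNIV) = S" using into onto by (force simp: image_iff)
  then show ?thesis using that compL contF by blast
qed

theorem theorem4:
  fixes S :: "real set"
  assumes "S \<noteq> {}"
    and "GCC_space (top_of_set S)"
  shows "\<exists>f :: real \<times> real \<Rightarrow> real.
           continuous_on (cantor_set \<times> UNIV) f \<and> f ` (cantor_set \<times> UNIV) = S"
proof -
  have "GCC_space (top_of_set (arctan ` S))"
    using assms(2) by (rule GCC_space_continuous_image[where h = arctan])
      (auto intro!: continuous_intros)
  moreover have "bounded (arctan ` S)"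
  proof (rule bounded_subset)
    show "arctan ` S \<subseteq> {-(pi/2)<..<pi/2}" using arctan_bounded by (simp only: image_subset_iff) simp
  qed simp
  ultimately obtain L and F :: "real \<times> real \<Rightarrow> real"
    where L: "compact L" and F: "continuous_on UNIV F" "F ` (L \<times> UNIV) = arctan ` S"
    using bounded_GCC_sweep by blast
  have "L \<noteq> {}" using F(2) assms(1) by auto
  then obtain \<psi> where \<psi>: "continuous_on cantor_set \<psi>" "\<psi> ` cantor_set = L"
    using compact_real_image_of_cantor_set L by blast
  define G where "G = (\<lambda>(c, t). F (\<psi> c, t))"
  have contG: "continuous_on (cantor_set \<times> UNIV) G"
    unfolding G_def case_prod_beta
    by (intro continuous_on_compose2[OF F(1)] continuous_intros continuous_on_compose2[OF \<psi>(1)]) auto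
  have imG: "G ` (cantor_set \<times> UNIV) = arctan ` S"
  proof -
    have "G ` (cantor_set \<times> UNIV) = F ` (\<psi> ` cantor_set \<times> UNIV)"
      unfolding G_def by force
    then show ?thesis using F(2) \<psi>(2) by simp
  qed
  have "continuous_on (arctan ` S) tan"
    by (intro continuous_intros) auto
  then have "continuous_on (cantor_set \<times> UNIV) (tan \<circ> G)"
    using contG imG by (metis continuous_on_compose)
  moreover have "(tan \<circ> G) ` (cantor_set \<times> UNIV) = S"
    unfolding image_comp[symmetric] imG by (simp add: image_image tan_arctan)
  ultimately show ?thesis by blast
qed

end
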